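(* Let $y:\mathbb{N}\to\mathbb{R}_{>0}$ be a monotone increasing function such that $y(n)\to\infty$ as $n\to\infty$ and $$y(n)<2^{-32}\log n\quad\text{for all sufficiently large } n.$$ Then the set $\mathcal{F}_y=\{n\in\mathbb{N}: p^+(n)\le y(n)\}$ is totally a-primitive.
   Context: $\mathbb{N}$ denotes the set of positive integers and $\mathbb{N}_0=\mathbb{N}\cup\{0\}$; $\log$ is the natural logarithm. For a positive integer $n$, $p^+(n)$ denotes the greatest prime factor of $n$ (with the convention $p^+(1)=1$). For a monotone increasing function $y$ on $\mathbb{N}$ with positive values, $n\in\mathbb{N}$ is called $y$-smooth if $p^+(n)\le y(n)$, and $\mathcal{F}_y$ is the set of all $y$-smooth positive integers. For sets $\mathcal{B},\mathcal{C}$ of non-negative integers, $\mathcal{B}+\mathcal{C}=\{b+c: b\in\mathcal{B},\ c\in\mathcal{C}\}$. A finite or infinite set $\mathcal{A}\subset\mathbb{N}_0$ is a-reducible if there are sets $\mathcal{B},\mathcal{C}\subset\mathbb{N}_0$ with $|\mathcal{B}|\ge 2$, $|\mathcal{C}|\ge 2$ and $\mathcal{A}=\mathcal{B}+\mathcal{C}$; if there are no such sets, $\mathcal{A}$ is a-primitive. Two sets $\mathcal{A},\mathcal{B}$ of non-negative integers are asymptotically equal, written $\mathcal{A}\sim\mathcal{B}$, if there is a number $K$ such that $\mathcal{A}\cap[K,+\infty)=\mathcal{B}\cap[K,+\infty)$. An infinite set $\mathcal{A}\subset\mathbb{N}_0$ is totally a-primitive if every $\mathcal{A}'\subset\mathbb{N}_0$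 with $\mathcal{A}'\sim\mathcal{A}$ is a-primitive. *)

theory Defs
  imports
    Complex_Main
    "HOL-Library.Set_Algebras"
    "HOL-Computational_Algebra.Primes"
begin

definition greatest_prime_factor :: "nat \<Rightarrow> nat" where
  "greatest_prime_factor n = (if n = 1 then 1 else Max (prime_factors n))"

(* y is a function on the positive integers; the value y 0 is never used. *)
definition smooth_numbers :: "(nat \<Rightarrow> real) \<Rightarrow> nat set" where
  "smooth_numbers y = {n. n \<ge> 1 \<and> real (greatest_prime_factor n) \<le> y n}"

(* card is 0 on infinite sets, so "at least two elements" needs the infinite case separately.
   The sum B + C is the elementwise sum of sets from Set_Algebras. *)
definition a_reducible :: "nat set \<Rightarrow> bool" where
  "a_reducible A \<longleftrightarrow>
     (\<exists>B C. (infinite B \<or> card B \<ge> 2) \<and> (infinite C \<or> card C \<ge> 2) \<and> A = B + C)"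

definition a_primitive :: "nat set \<Rightarrow> bool" where
  "a_primitive A \<longleftrightarrow> \<not> a_reducible A"

definition asymptotically_equal :: "nat set \<Rightarrow> nat set \<Rightarrow> bool" where
  "asymptotically_equal A B \<longleftrightarrow> (\<exists>K. A \<inter> {K..} = B \<inter> {K..})"

definition totally_a_primitive :: "nat set \<Rightarrow> bool" where
  "totally_a_primitive A \<longleftrightarrow>
     infinite A \<and> (\<forall>A'. asymptotically_equal A' A \<longrightarrow> a_primitive A')"

end

theory Submission
  imports Defs "HOL-Library.FuncSet" "HOL-Computational_Algebra.Squarefree"
begin

text \<open>
  Suppose that a set asymptotically equal to the smooth numbers is a sum \<open>B + C\<close>. The proof counts
  elements up to a well chosen size \<open>N\<close>, and finds \<open>B\<close> and \<open>C\<close> too thin to produce all smooth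
  numbers between \<open>N\<close> and \<open>2N\<close>.

  Take \<open>N\<close> to be a power of 4 such that the set \<open>S\<close> of admissible primes (those up to \<open>y N\<close>) does
  not change between \<open>N\<close> and \<open>4N\<close>. As the number of admissible primes grows at most like a small
  multiple of \<open>log N\<close>, it cannot increase at each power of 4, so there are arbitrarily large such
  \<open>N\<close> (\<open>ex_stationary_index\<close>). Let \<open>s\<close> be the number of primes in \<open>S\<close>.

  \<^item> Upper bound. Fix \<open>b < b'\<close> in \<open>B\<close> and put \<open>d = b' - b\<close>. For each \<open>c\<close> in \<open>C\<close>, both \<open>x = c + b\<close> and
    \<open>x + d\<close> are smooth. Within a dyadic interval \<open>(H, 2H]\<close> an elementary gap principle shows that
    there are at most \<open>32 ^ s\<close> such \<open>x\<close> (\<open>card_S_pairs_dyadic_le\<close>): the number \<open>x (x + d)\<close> has size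
    about \<open>H\<^sup>2\<close>, so two solutions whose prime exponents nearly agree are congruent modulo a
    number larger than \<open>H\<close> and hence equal. Summing over the dyadic intervals, the number of elements
    of \<open>C\<close> up to \<open>2N\<close> is at most of order \<open>log N * 32 ^ s\<close>, and the same holds for \<open>B\<close> by symmetry.

  \<^item> Lower bound. The smooth numbers between \<open>N\<close> and \<open>2N\<close> include one for each exponent vector over
    the odd primes of \<open>S\<close> in a box, the power of 2 being used to reach the interval. With \<open>\<theta>\<close> the
    sum of the logarithms of these primes, the inequality of arithmetic and geometric means gives at
    least \<open>(log N / \<theta>) ^ (s - 1)\<close> of them (\<open>card_S_numbers_dyadic_ge\<close>). As \<open>\<theta> \<le> 2 y N\<close> by
    Chebyshev's bound for the primorial, the base of this power is at least \<open>2 ^ 31\<close>.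

  The product of the two upper bounds is of order \<open>(log N)\<^sup>2 * 2 ^ (10 s)\<close>. The factor
  \<open>(log N)\<^sup>2\<close> is absorbed since \<open>y N\<close> is at most of order \<open>4 ^ s\<close> (\<open>le_4_power_card_primes\<close>), so
  the lower bound wins as soon as \<open>s \<ge> 6\<close>.
\<close>

section \<open>Numbers composed of a given set of primes\<close>

definition S_numbers :: "nat set \<Rightarrow> nat set" where
  "S_numbers S = {n. n > 0 \<and> prime_factors n \<subseteq> S}"

text \<open>
  Give each vector \<open>k\<close> the weight \<open>2 ^ (- sum k S)\<close>. Every vector counted here weighs at least
  \<open>2 ^ (- T)\<close>, whereas the total weight is a product of geometric sums, each below 2.
\<close>
lemma card_exponent_vectors_le:
  fixes S :: "'a set"
  assumes "finite S"
  shows "card {k \<in> S \<rightarrow>\<^sub>E {..T::nat}. sum k S \<le> T} \<le> 2 ^ (T + card S)"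
proof -
  let ?V = "{k \<in> S \<rightarrow>\<^sub>E {..T}. sum k S \<le> T}"
  have fin: "finite (S \<rightarrow>\<^sub>E {..T})" using assms by (intro finite_PiE) auto
  have geom: "(\<Sum>i\<le>T. (1/2::real) ^ i) \<le> 2"
    by (simp add: sum_gp0)
  have "real (card ?V) * (1/2) ^ T = (\<Sum>k\<in>?V. (1/2::real) ^ T)" by simp
  also have "\<dots> \<le> (\<Sum>k\<in>?V. (1/2) ^ sum k S)"
    by (intro sum_mono power_decreasing) auto
  also have "\<dots> \<le> (\<Sum>k\<in>S \<rightarrow>\<^sub>E {..T}. (1/2) ^ sum k S)"
    using fin by (intro sum_mono2) auto
  also have "\<dots> = (\<Sum>k\<in>S \<rightarrow>\<^sub>E {..T}. \<Prod>p\<in>S. (1/2) ^ k p)"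
    by (simp add: power_sum)
  also have "\<dots> = (\<Prod>p\<in>S. \<Sum>i\<le>T. (1/2::real) ^ i)"
    using assms by (subst prod_sum_PiE) auto
  also have "\<dots> \<le> (\<Prod>p\<in>S. 2)"
    using geom by (intro prod_mono conjI) (auto intro!: sum_nonneg)
  also have "\<dots> = 2 ^ card S" by simp
  finally have "real (card ?V) * (1/2) ^ T * 2 ^ T \<le> 2 ^ card S * 2 ^ T"
    by (intro mult_right_mono) auto
  hence "real (card ?V) \<le> 2 ^ (T + card S)"
    by (simp add: power_add power_divide mult.commute)
  thus ?thesis by (metis of_nat_le_iff of_nat_numeral of_nat_power)
qed

lemma ln_eq_sum_multiplicity:
  assumes "finite S" "\<And>p. p \<in> S \<Longrightarrow> prime p" "n \<in> S_numbers S"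
  shows "ln (real n) = (\<Sum>p\<in>S. real (multiplicity p n) * ln (real p))"
proof -
  have n: "n > 0" "prime_factors n \<subseteq> S" using assms(3) by (auto simp: S_numbers_def)
  have "real n = real (\<Prod>p\<in>prime_factors n. p ^ multiplicity p n)"
    using n by (subst prod_prime_factors) auto
  also have "\<dots> = (\<Prod>p\<in>prime_factors n. real p ^ multiplicity p n)" by simp
  also have "\<dots> = (\<Prod>p\<in>S. real p ^ multiplicity p n)"
    using n assms by (intro prod.mono_neutral_left) (auto simp: prime_factors_multiplicity)
  finally have "ln (real n) = ln (\<Prod>p\<in>S. real p ^ multiplicity p n)" by simp
  also have "\<dots> = (\<Sum>p\<in>S. ln (real p ^ multiplicity p n))"
    using assms by (subst ln_prod) (auto dest!: prime_gt_0_nat)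
  also have "\<dots> = (\<Sum>p\<in>S. real (multiplicity p n) * ln (real p))"
    using assms by (intro sum.cong ln_realpow) (auto dest!: prime_gt_0_nat)
  finally show ?thesis .
qed

lemma multiplicity_lcm_nat:
  fixes a b :: nat
  assumes "prime p" "a > 0" "b > 0"
  shows "multiplicity p (lcm a b) = max (multiplicity p a) (multiplicity p b)"
proof -
  have "count (prime_factorization (lcm a b)) p = 
     max (count (prime_factorization a) p) (count (prime_factorization b) p)"
    using assms by (simp add: prime_factorization_lcm)
  thus ?thesis using assms by (simp add: count_prime_factorization_prime)
qed

lemma multiplicity_gcd_nat:
  fixes a b :: nat
  assumes "prime p" "a > 0" "b > 0"
  shows "multiplicity p (gcd a b) = min (multiplicity p a) (multiplicity p b)"
proof -
  have "count (prime_factorization (gcd a b)) p = 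
     min (count (prime_factorization a) p) (count (prime_factorization b) p)"
    using assms by (simp add: prime_factorization_gcd)
  thus ?thesis using assms by (simp add: count_prime_factorization_prime)
qed

section \<open>The gap principle for pairs of smooth numbers\<close>

text \<open>
  Let \<open>L x = lcm x (x + d)\<close>, which is at least \<open>x (x + d) / d\<close> because \<open>gcd x (x + d)\<close> divides \<open>d\<close>.
  Each \<open>x\<close> is classified by two data: for which primes the exponent of \<open>L x\<close> is attained at \<open>x\<close>
  rather than at \<open>x + d\<close>, and the exponents of \<open>L x\<close>, measured on a logarithmic scale and rounded
  down to multiples of \<open>u\<close>. If \<open>x < x'\<close> are in the same class, then \<open>Q = gcd (L x) (L x')\<close> divides
  \<open>x' - x\<close>, since each of its prime powers divides both \<open>x\<close> and \<open>x'\<close> or both \<open>x + d\<close> and \<open>x' + d\<close>.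
  Rounding loses a factor of at most \<open>exp (s u) = H / d\<close>, so that \<open>Q \<ge> L x * d / H > H\<close>,
  which contradicts \<open>x' - x < H\<close>. Hence each class has at most one element, and there are at
  most \<open>2 ^ s * 2 ^ (4 s)\<close> classes.
\<close>
lemma card_S_pairs_dyadic_le:
  fixes S :: "nat set" and d H :: nat
  assumes fin: "finite S" and pr: "\<And>p. p \<in> S \<Longrightarrow> prime p" and ne: "S \<noteq> {}"
    and d: "d > 0" and H: "H \<ge> 6 * d ^ 3"
  shows "card {x \<in> {H<..2*H}. x \<in> S_numbers S \<and> x + d \<in> S_numbers S} \<le> 32 ^ card S"
proof -
  define s where "s = card S"
  define X where "X = {x \<in> {H<..2*H}. x \<in> S_numbers S \<and> x + d \<in> S_numbers S}"
  \<comment> \<open>The mesh \<open>u\<close> is the coarsest one for which the total rounding error \<open>s u\<close> still leaves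
    the common divisor of two numbers of the same class above \<open>H\<close>.\<close>
  define u where "u = ln (real H / real d) / real s"
  define L where "L = (\<lambda>x. lcm x (x + d))"
  define k where "k = (\<lambda>x. \<lambda>p\<in>S. nat \<lfloor>real (multiplicity p (L x)) * ln (real p) / u\<rfloor>)"
  define side where "side = (\<lambda>x. {p\<in>S. multiplicity p (x + d) \<le> multiplicity p x})"
  have s: "s > 0" using fin ne by (simp add: s_def card_gt_0_iff)
  have "d \<le> d ^ 3" using d by (simp add: self_le_power)
  hence dH: "d < H" using H d by linarith
  have u: "u > 0" using dH d s by (auto simp: u_def intro!: divide_pos_pos ln_gt_zero)
  have su: "real s * u = ln (real H / real d)" using s by (simp add: u_def)
  have L_in: "L x \<in> S_numbers S" if "x \<in> X" for x
    using that by (auto simp: X_def L_def S_numbers_def prime_factorization_lcm lcm_pos_nat)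
  have pos: "x > 0" "L x > 0" if "x \<in> X" for x
    using that L_in[OF that] by (auto simp: X_def S_numbers_def)
  have lnL: "ln (real (L x)) = (\<Sum>p\<in>S. real (multiplicity p (L x)) * ln (real p))" if "x \<in> X" for x
    by (rule ln_eq_sum_multiplicity[OF fin pr L_in[OF that]])
  have nonneg: "real (multiplicity p n) * ln (real p) / u \<ge> 0" if "p \<in> S" for p n
    using pr[OF that] u by (auto intro!: divide_nonneg_pos mult_nonneg_nonneg dest: prime_gt_0_nat)
  have k_le: "real (k x p) \<le> real (multiplicity p (L x)) * ln (real p) / u" if "p \<in> S" for x p
    using nonneg[OF that] that by (simp add: k_def)
  have k_gt: "real (multiplicity p (L x)) * ln (real p) / u < real (k x p) + 1" if "p \<in> S" for x p
    using nonneg[OF that] that by (simp add: k_def)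
  \<comment> \<open>Since \<open>L x \<le> 6 H\<^sup>2\<close>, the hypothesis \<open>H \<ge> 6 d\<^sup>3\<close> says exactly that this is at most
    \<open>(H / d)\<^sup>3 = exp (3 s u)\<close>, which bounds the rounded exponents.\<close>
  have sum_k: "sum (k x) S \<le> 3 * s" if x: "x \<in> X" for x
  proof -
    have "real (\<Sum>p\<in>S. k x p) \<le> (\<Sum>p\<in>S. real (multiplicity p (L x)) * ln (real p) / u)"
      by (simp add: sum_mono k_le)
    also have "\<dots> = ln (real (L x)) / u"
      by (simp add: lnL[OF x] sum_divide_distrib)
    also have "ln (real (L x)) \<le> 3 * ln (real H / real d)"
    proof -
      have "L x \<le> x * (x + d)" unfolding L_def using pos[OF x]
        by (intro dvd_imp_le lcm_least) auto
      also have "\<dots> \<le> (2 * H) * (3 * H)" using x dH by (intro mult_mono) (auto simp: X_def)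
      finally have "L x \<le> 6 * H ^ 2" by (simp add: power2_eq_square)
      hence "L x * d ^ 3 \<le> (6 * d ^ 3) * H ^ 2" by (simp add: algebra_simps)
      also have "\<dots> \<le> H * H ^ 2" using H by (intro mult_right_mono) auto
      finally have "real (L x * d ^ 3) \<le> real (H ^ 3)"
        by (subst of_nat_le_iff) (simp add: power3_eq_cube power2_eq_square)
      hence "real (L x) \<le> (real H / real d) ^ 3"
        using d by (simp add: power_divide field_simps)
      hence "ln (real (L x)) \<le> ln ((real H / real d) ^ 3)" using pos[OF x] 
        by (subst ln_le_cancel_iff) (use d dH in auto)
      also have "\<dots> = 3 * ln (real H / real d)" using d dH by (subst ln_realpow) auto
      finally show ?thesis .
    qed
    hence "ln (real (L x)) / u \<le> 3 * ln (real H / real d) / u" using u by (simp add: divide_right_mono)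
    also have "\<dots> = 3 * real s" using u su by (simp add: field_simps)
    finally show ?thesis by linarith
  qed
  have gap: False if x: "x \<in> X" and x': "x' \<in> X" and lt: "x < x'" and sk: "k x = k x'"
    and ss: "side x = side x'" for x x'
  proof -
    define Q where "Q = gcd (L x) (L x')"
    have Qpos: "Q > 0" using pos[OF x] by (simp add: Q_def)
    have Q_in: "Q \<in> S_numbers S"
      using L_in[OF x] dvd_prime_factors[of "L x" Q] pos[OF x] Qpos by (auto simp: S_numbers_def Q_def)
    have mQ: "multiplicity p Q = min (multiplicity p (L x)) (multiplicity p (L x'))" if "prime p" for p
      unfolding Q_def using that pos x x' by (intro multiplicity_gcd_nat) auto
    have mL: "multiplicity p (L z) = max (multiplicity p z) (multiplicity p (z + d))"
      if "prime p" "z \<in> X" for p z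
      unfolding L_def using that pos by (intro multiplicity_lcm_nat) auto
    have "Q dvd x' - x"
    proof (rule multiplicity_le_imp_dvd)
      show "Q \<noteq> 0" using Qpos by simp
    next
      fix p :: nat assume p: "prime p"
      have "p ^ multiplicity p Q dvd x' - x"
      proof (cases "p \<in> S")
        case False
        hence "multiplicity p Q = 0"
          using Q_in p Qpos by (auto simp: S_numbers_def prime_factors_multiplicity)
        thus ?thesis by simp
      next
        case pS: True
        show ?thesis
        proof (cases "p \<in> side x")
          case True
          hence "p \<in> side x'" using ss by simp
          hence "p ^ multiplicity p Q dvd x" "p ^ multiplicity p Q dvd x'" using True
            by (auto intro!: multiplicity_dvd' simp: mQ mL p x x' side_def)
          thus ?thesis by (rule dvd_diff_nat[rotated])
        next
          case False
          hence "p \<notin> side x'" using ss by simp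
          hence "p ^ multiplicity p Q dvd x + d" "p ^ multiplicity p Q dvd x' + d" using False pS
            by (auto intro!: multiplicity_dvd' simp: mQ mL p x x' side_def)
          hence "p ^ multiplicity p Q dvd (x' + d) - (x + d)" by (rule dvd_diff_nat[rotated])
          thus ?thesis by simp
        qed
      qed
      thus "multiplicity p Q \<le> multiplicity p (x' - x)"
        using lt p by (intro multiplicity_geI) auto
    qed
    hence "Q \<le> x' - x" using lt by (intro dvd_imp_le) auto
    hence QH: "Q < H" using x x' by (auto simp: X_def)
    have "ln (real (L x)) - real s * u = (\<Sum>p\<in>S. real (multiplicity p (L x)) * ln (real p) - u)"
      by (simp add: lnL[OF x] sum_subtractf s_def)
    also have "\<dots> \<le> (\<Sum>p\<in>S. real (multiplicity p Q) * ln (real p))"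
    proof (intro sum_mono)
      fix p assume p: "p \<in> S"
      have a: "real (k x p) * u \<le> real (multiplicity p (L z)) * ln (real p)" if "z = x \<or> z = x'" for z
        using k_le[OF p, of z] u that sk by (auto simp: field_simps)
      have "real (multiplicity p (L x)) * ln (real p) < (real (k x p) + 1) * u"
        using k_gt[OF p, of x] u by (simp add: field_simps)
      moreover have "real (k x p) * u \<le> real (multiplicity p Q) * ln (real p)"
        using a[of x] a[of x'] pr[OF p] by (auto simp: mQ min_def)
      ultimately show "real (multiplicity p (L x)) * ln (real p) - u \<le> real (multiplicity p Q) * ln (real p)"
        by (simp add: algebra_simps)
    qed
    also have "\<dots> = ln (real Q)" by (rule ln_eq_sum_multiplicity[OF fin pr Q_in, symmetric])
    finally have 1: "ln (real (L x)) \<le> ln (real Q) + ln (real H / real d)" using su by simp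
    have "ln (real Q) + ln (real H / real d) = ln (real Q * (real H / real d))"
      using Qpos d dH by (subst ln_mult) auto
    with 1 have "real (L x) \<le> real Q * (real H / real d)"
      using Qpos d dH pos[OF x] by simp
    hence "real (L x) * real d \<le> real Q * real H" using d by (simp add: field_simps)
    hence LQ: "L x * d \<le> Q * H" by (metis of_nat_le_iff of_nat_mult)
    have "H * H < x * (x + d)" using x dH by (intro mult_strict_mono) (auto simp: X_def)
    also have "\<dots> = L x * gcd x (x + d)"
      unfolding L_def using prod_gcd_lcm_nat[of x "x + d"] by (simp only: mult.commute)
    also have "gcd x (x + d) = gcd x d" by simp
    also have "L x * gcd x d \<le> L x * d" using d by (intro mult_left_mono gcd_le2_nat) auto
    also note LQ
    also have "Q * H \<le> H * H" using QH by simp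
    finally show False by simp
  qed
  define V where "V = {k \<in> S \<rightarrow>\<^sub>E {..3*s}. sum k S \<le> 3 * s}"
  have finV: "finite V" unfolding V_def using fin by (auto intro!: finite_PiE)
  have "inj_on (\<lambda>x. (side x, k x)) X"
  proof (rule inj_onI)
    fix x x' assume "x \<in> X" "x' \<in> X" "(side x, k x) = (side x', k x')"
    thus "x = x'" using gap[of x x'] gap[of x' x] by (cases x x' rule: linorder_cases) auto
  qed
  moreover have "(\<lambda>x. (side x, k x)) ` X \<subseteq> Pow S \<times> V"
  proof -
    have "k x \<in> V" if "x \<in> X" for x
    proof -
      have "k x p \<le> 3 * s" if "p \<in> S" for p
        using sum_k[OF \<open>x \<in> X\<close>] member_le_sum[OF that, of "k x"] fin by simp
      moreover have "k x \<in> extensional S" by (simp add: k_def)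
      ultimately show ?thesis using sum_k[OF that] by (auto simp: V_def PiE_iff)
    qed
    thus ?thesis by (auto simp: side_def)
  qed
  ultimately have "card X \<le> card (Pow S \<times> V)"
    using fin finV by (intro card_inj_on_le[of "\<lambda>x. (side x, k x)"]) auto
  also have "\<dots> = 2 ^ s * card V" using fin by (simp add: card_cartesian_product card_Pow s_def)
  also have "card V \<le> 2 ^ (3 * s + s)"
    unfolding V_def using card_exponent_vectors_le[OF fin, of "3 * s"] by (simp add: s_def)
  also have "2 ^ s * (2::nat) ^ (3 * s + s) = 32 ^ s"
    by (simp add: power_add[symmetric] power_mult[symmetric] flip: power_mult) (simp add: power_mult)
  finally show ?thesis by (simp add: X_def s_def)
qed

text \<open>
  The gap principle applies above \<open>6 d\<^sup>3\<close>, so \<open>m\<close> doublings of this starting point suffice.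
\<close>
lemma card_S_pairs_le:
  fixes S :: "nat set" and d m :: nat
  assumes fin: "finite S" and pr: "\<And>p. p \<in> S \<Longrightarrow> prime p" and ne: "S \<noteq> {}"
    and d: "d > 0"
  shows "card {x \<in> {..2 ^ m}. x \<in> S_numbers S \<and> x + d \<in> S_numbers S} \<le> 6 * d ^ 3 + m * 32 ^ card S"
proof -
  define P where "P = (\<lambda>x. x \<in> S_numbers S \<and> x + d \<in> S_numbers S)"
  define H where "H = 6 * d ^ 3"
  have "H > 0" using d by (simp add: H_def)
  have "card {x \<in> {..H * 2 ^ m}. P x} \<le> H + m * 32 ^ card S"
  proof (induction m)
    case 0
    have "card {x \<in> {..H * 2 ^ 0}. P x} \<le> card {1..H}"
      by (intro card_mono) (auto simp: P_def S_numbers_def)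
    thus ?case by simp
  next
    case (Suc m)
    have "{x \<in> {..H * 2 ^ Suc m}. P x} \<subseteq>
       {x \<in> {..H * 2 ^ m}. P x} \<union> {x \<in> {H * 2 ^ m<..2 * (H * 2 ^ m)}. P x}" by auto
    hence "card {x \<in> {..H * 2 ^ Suc m}. P x} \<le>
       card ({x \<in> {..H * 2 ^ m}. P x} \<union> {x \<in> {H * 2 ^ m<..2 * (H * 2 ^ m)}. P x})"
      by (intro card_mono) auto
    also have "\<dots> \<le> card {x \<in> {..H * 2 ^ m}. P x} + card {x \<in> {H * 2 ^ m<..2 * (H * 2 ^ m)}. P x}"
      by (rule card_Un_le)
    also have "card {x \<in> {H * 2 ^ m<..2 * (H * 2 ^ m)}. P x} \<le> 32 ^ card S"
      unfolding P_def using fin pr ne d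
      by (intro card_S_pairs_dyadic_le) (auto simp: H_def)
    finally show ?case using Suc by simp
  qed
  moreover have "card {x \<in> {..2 ^ m}. P x} \<le> card {x \<in> {..H * 2 ^ m}. P x}"
  proof (intro card_mono)
    have "(2::nat) ^ m \<le> H * 2 ^ m" using \<open>H > 0\<close> by simp
    thus "{x \<in> {..2 ^ m}. P x} \<subseteq> {x \<in> {..H * 2 ^ m}. P x}"
      by (auto intro: order_trans)
  qed auto
  ultimately show ?thesis by (simp add: P_def H_def)
qed

section \<open>Chebyshev-type bounds for the primes\<close>

lemma prod_prime_divisors_le:
  fixes n :: nat
  assumes "n > 0" "T \<subseteq> prime_factors n"
  shows "\<Prod>T \<le> n"
proof -
  have "\<Prod>T dvd \<Prod>(prime_factors n)" using assms by (intro prod_dvd_prod_subset) auto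
  also have "\<dots> dvd (\<Prod>p\<in>prime_factors n. p ^ multiplicity p n)"
    by (intro prod_dvd_prod) (auto simp: prime_factors_multiplicity)
  also have "\<dots> = n" using assms by (subst prod_prime_factors) auto
  finally show ?thesis using assms by (intro dvd_imp_le)
qed

text \<open>
  The primes in \<open>(m + 1, 2 m + 1]\<close> all divide \<open>(2 m + 1) choose m\<close>, which is at
  most \<open>4 ^ m\<close> as it occurs twice in the corresponding row of Pascal's triangle.
\<close>
lemma primorial_le: "\<Prod>{p::nat. prime p \<and> p \<le> n} \<le> 4 ^ n"
proof (induction n rule: less_induct)
  case (less n)
  consider "n \<le> 1" | "n = 2" | "n > 2" "even n" | m where "m > 0" "n = 2 * m + 1"
    by (metis One_nat_def Suc_eq_plus1 gr0I leI less_2_cases_iff less_one mult_0_right nat_less_le oddE)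
  thus ?case
  proof cases
    case 1
    hence "{p::nat. prime p \<and> p \<le> n} = {}" by (auto dest: prime_gt_1_nat)
    thus ?thesis by (simp only: prod.empty) simp
  next
    case 2
    hence "{p::nat. prime p \<and> p \<le> n} = {2}" by (auto dest: prime_gt_1_nat)
    thus ?thesis using 2 by simp
  next
    case 3
    hence "\<not> prime n" using prime_odd_nat by blast
    hence "{p::nat. prime p \<and> p \<le> n} = {p. prime p \<and> p \<le> n - 1}"
      using 3 by (auto simp: le_less)
    also have "\<Prod>\<dots> \<le> 4 ^ (n - 1)" using 3 by (intro less.IH) auto
    also have "\<dots> \<le> 4 ^ n" by (intro power_increasing) auto
    finally show ?thesis .
  next
    case (4 m)
    let ?c = "(2 * m + 1) choose m"
    let ?T = "{p::nat. prime p \<and> m + 1 < p \<and> p \<le> 2 * m + 1}"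
    have "\<Prod>?T \<le> ?c"
    proof (intro prod_prime_divisors_le subsetI)
      show "?c > 0" by simp
    next
      fix p assume p: "p \<in> ?T"
      have "fact m * fact (2 * m + 1 - m) * ?c = (fact (2 * m + 1) :: nat)"
        by (intro binomial_fact_lemma) auto
      moreover have "p dvd fact (2 * m + 1)"
        using p by (auto simp: prime_dvd_fact_iff simp del: fact_Suc)
      moreover have "\<not> p dvd fact m" "\<not> p dvd fact (2 * m + 1 - m)"
        using p by (auto simp: prime_dvd_fact_iff simp del: fact_Suc)
      ultimately have "p dvd ?c" using p
        by (metis (no_types, lifting) mem_Collect_eq prime_dvd_mult_iff)
      thus "p \<in> prime_factors ?c" using p by (intro prime_factorsI) auto
    qed
    also have "?c \<le> 4 ^ m"
    proof -
      have "2 * ?c = (\<Sum>k\<in>{m, m + 1}. (2 * m + 1) choose k)"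
        using binomial_symmetric[of m "2 * m + 1"] by simp
      also have "\<dots> \<le> (\<Sum>k\<le>2 * m + 1. (2 * m + 1) choose k)" by (intro sum_mono2) auto
      also have "\<dots> = 2 * 4 ^ m" using choose_row_sum[of "2 * m + 1"] by (simp add: power_mult)
      finally show ?thesis by simp
    qed
    finally have 1: "\<Prod>?T \<le> 4 ^ m" .
    have split: "{p::nat. prime p \<and> p \<le> n} = {p. prime p \<and> p \<le> m + 1} \<union> ?T" using 4 by auto
    have "m + 1 < n" using 4 by linarith
    hence 2: "\<Prod>{p. prime p \<and> p \<le> m + 1} \<le> 4 ^ (m + 1)" by (rule less.IH)
    have "\<Prod>{p::nat. prime p \<and> p \<le> n} = \<Prod>{p. prime p \<and> p \<le> m + 1} * \<Prod>?T"
      unfolding split by (rule prod.union_disjoint) auto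
    also have "\<dots> \<le> 4 ^ (m + 1) * 4 ^ m"
      by (rule mult_mono[OF 2 1]) (rule le0)+
    also have "\<dots> = 4 ^ (m + 1 + m)" by (rule power_add[symmetric])
    also have "m + 1 + m = n" using 4 by simp
    finally show ?thesis .
  qed
qed

lemma squarefree_part_eq_prod: "squarefree_part (n::nat) = \<Prod>(prime_factors (squarefree_part n))"
proof -
  let ?q = "squarefree_part n"
  have "?q = (\<Prod>p\<in>prime_factors ?q. p ^ multiplicity p ?q)"
    using squarefree_part_nonzero[of n] by (subst prod_prime_factors) auto
  also have "\<dots> = \<Prod>(prime_factors ?q)"
  proof (intro prod.cong refl)
    fix p assume "p \<in> prime_factors ?q"
    hence "multiplicity p ?q > 0" "multiplicity p ?q \<le> Suc 0"
      using prime_multiplicity_squarefree_part_le_Suc_0[of p n] by (auto simp: prime_factors_multiplicity)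
    thus "p ^ multiplicity p ?q = p" by (simp add: le_Suc_eq)
  qed
  finally show ?thesis .
qed

text \<open>
  This is Erdos' argument for the infinitude of the primes. Every positive \<open>n \<le> m\<close> is a squarefree
  number times a square. The squarefree part is determined by its set of prime factors and the
  square root of the square part is at most \<open>sqrt m\<close>, so \<open>m \<le> 2 ^ \<pi> * sqrt m\<close> where \<open>\<pi>\<close> is the
  number of primes up to \<open>m\<close>.
\<close>
lemma le_4_power_card_primes: "m \<le> 4 ^ card {p::nat. prime p \<and> p \<le> m}"
proof (cases "m = 0")
  case False
  let ?P = "{p::nat. prime p \<and> p \<le> m}"
  define r where "r = nat \<lfloor>sqrt (real m)\<rfloor>"
  let ?f = "\<lambda>n::nat. (prime_factors (squarefree_part n), square_part n)"
  have "inj_on ?f {1..m}"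
    by (intro inj_onI) (metis Pair_inject squarefree_decompose squarefree_part_eq_prod)
  moreover have "?f ` {1..m} \<subseteq> Pow ?P \<times> {1..r}"
  proof safe
    fix n assume n: "n \<in> {1..m}"
    have dec: "n = squarefree_part n * square_part n ^ 2" by (rule squarefree_decompose)
    {
      fix p assume "p \<in> prime_factors (squarefree_part n)"
      hence p: "prime p" "p dvd squarefree_part n" by auto
      hence "p dvd n" by (subst dec) (rule dvd_mult2)
      with p show "prime p" "p \<le> m" using n dvd_imp_le[of p n] by auto
    }
    have "square_part n ^ 2 \<le> m" using n square_part_square_dvd[of n] dvd_imp_le[of "square_part n ^ 2" n] by auto
    hence "real (square_part n ^ 2) \<le> real m" by (rule of_nat_mono)
    hence "real (square_part n) \<le> sqrt (real m)" by (intro real_le_rsqrt) simp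
    moreover have "square_part n > 0" using n by (auto intro: gr0I)
    ultimately show "square_part n \<in> {1..r}" by (auto simp: r_def le_nat_floor)
  qed
  ultimately have "card {1..m} \<le> card (Pow ?P \<times> {1..r})"
    by (intro card_inj_on_le[of ?f]) auto
  hence "m \<le> 2 ^ card ?P * r" by (simp add: card_cartesian_product card_Pow)
  hence "m ^ 2 \<le> (2 ^ card ?P * r) ^ 2" by (intro power_mono) auto
  also have "\<dots> = 4 ^ card ?P * r ^ 2" by (simp add: power_mult_distrib power_mult[symmetric] mult.commute flip: power_mult) (simp add: power_mult)
  also have "r ^ 2 \<le> m"
  proof -
    have "real r \<le> sqrt (real m)" by (simp add: r_def)
    hence "real r ^ 2 \<le> sqrt (real m) ^ 2" by (intro power_mono) auto
    hence "real (r ^ 2) \<le> real m" by simp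
    thus ?thesis by (subst (asm) of_nat_le_iff)
  qed
  finally have "m * m \<le> 4 ^ card ?P * m" by (simp add: power2_eq_square)
  thus ?thesis using False by simp
qed auto

section \<open>A lower bound for smooth numbers in a dyadic interval\<close>

lemma power2_shift_exists:
  fixes n N :: nat
  assumes "n > 0" "n \<le> N"
  shows "\<exists>k. 2 ^ k * n \<in> {N<..2*N}"
proof -
  define k where "k = (LEAST k. N < 2 ^ k * n)"
  have "N < 2 ^ N" by simp
  also have "(2::nat) ^ N \<le> 2 ^ N * n" using assms by simp
  finally have ex: "N < 2 ^ N * n" .
  have 1: "N < 2 ^ k * n" unfolding k_def by (rule LeastI[of _ N]) (rule ex)
  have "k \<noteq> 0" using 1 assms by (intro notI) simp
  then obtain j where j: "k = Suc j" by (cases k) auto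
  have "\<not> N < 2 ^ j * n" using not_less_Least[of j "\<lambda>k. N < 2 ^ k * n"] j by (simp add: k_def)
  hence "2 ^ k * n \<le> 2 * N" using j by simp
  thus ?thesis using 1 by auto
qed

text \<open>
  With \<open>t\<close> primes in \<open>S\<close>, all products with exponents \<open>a p \<le> ln N / (t ln p)\<close> are at most \<open>N\<close>, and
  multiplication by a power of 2 moves each into the interval without changing the
  exponents at the odd primes. This gives at least \<open>\<Prod>p. ln N / (t ln p)\<close> numbers, and the
  inequality of arithmetic and geometric means replaces each \<open>t ln p\<close> by \<open>\<theta> = \<Sum>p. ln p\<close>.
\<close>
lemma card_S_numbers_dyadic_ge:
  fixes S :: "nat set" and N :: nat
  assumes fin: "finite S" and pr: "\<And>p. p \<in> S \<Longrightarrow> prime p \<and> odd p" and ne: "S \<noteq> {}" and N: "N \<ge> 1"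
  shows "(ln (real N) / (\<Sum>p\<in>S. ln (real p))) ^ card S \<le> 
            real (card {n \<in> {N<..2*N}. n \<in> S_numbers (insert 2 S)})"
proof -
  define t where "t = card S"
  define \<theta> where "\<theta> = (\<Sum>p\<in>S. ln (real p))"
  define l where "l = ln (real N)"
  have l: "l \<ge> 0" using N by (simp add: l_def)
  have t: "t > 0" using fin ne by (simp add: t_def card_gt_0_iff)
  have lnp: "ln (real p) > 0" if "p \<in> S" for p using pr[OF that] prime_gt_1_nat[of p] by auto
  have \<theta>: "\<theta> > 0" unfolding \<theta>_def using fin ne lnp by (intro sum_pos) auto
  define b where "b = (\<lambda>p. nat \<lfloor>l / (real t * ln (real p))\<rfloor>)"
  define E where "E = PiE S (\<lambda>p. {..b p})"
  define h where "h = (\<lambda>a::nat \<Rightarrow> nat. \<Prod>p\<in>S. p ^ a p)"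
  have ppos: "p > 0" if "p \<in> S" for p using pr[OF that] prime_gt_0_nat by auto
  have hpos: "h a > 0" for a unfolding h_def using ppos by (intro prod_pos) auto
  have h_le: "h a \<le> N" if "a \<in> E" for a
  proof -
    have "ln (real (h a)) = (\<Sum>p\<in>S. ln (real p ^ a p))"
      unfolding h_def using ppos fin by (simp add: ln_prod)
    also have "\<dots> = (\<Sum>p\<in>S. real (a p) * ln (real p))"
      using ppos by (intro sum.cong ln_realpow) auto
    also have "\<dots> \<le> (\<Sum>p\<in>S. l / real t)"
    proof (intro sum_mono)
      fix p assume p: "p \<in> S"
      have "a p \<le> b p" using that p by (auto simp: E_def)
      hence "real (a p) \<le> real (b p)" by simp
      also have "\<dots> \<le> l / (real t * ln (real p))" using l t lnp[OF p] by (simp add: b_def)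
      finally show "real (a p) * ln (real p) \<le> l / real t" using t lnp[OF p] by (simp add: field_simps)
    qed
    also have "\<dots> = ln (real N)" using t by (simp add: t_def l_def)
    finally show ?thesis using hpos[of a] N by simp
  qed
  define k where "k = (\<lambda>a. SOME k. 2 ^ k * h a \<in> {N<..2*N})"
  define g where "g = (\<lambda>a. 2 ^ k a * h a)"
  have g_in: "g a \<in> {N<..2*N}" if "a \<in> E" for a
    unfolding g_def k_def by (rule someI_ex, rule power2_shift_exists) (use hpos h_le that in auto)
  have mult_g: "multiplicity p (g a) = a p" if "p \<in> S" for p a
  proof -
    have p: "prime p" "odd p" using pr[OF that] by auto
    hence "\<not> p dvd 2 ^ k a" by (metis even_numeral prime_dvd_power primes_dvd_imp_eq two_is_prime_nat)
    hence "multiplicity p (2 ^ k a) = 0" by (rule not_dvd_imp_multiplicity_0)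
    hence "multiplicity p (g a) = multiplicity p (h a)" unfolding g_def using p hpos[of a]
      by (subst prime_elem_multiplicity_mult_distrib) auto
    also have "\<dots> = a p" unfolding h_def using that pr fin by (subst multiplicity_prod_prime_powers) auto
    finally show ?thesis .
  qed
  have "inj_on g E"
  proof (intro inj_onI)
    fix a a' assume aa: "a \<in> E" "a' \<in> E" "g a = g a'"
    show "a = a'"
      by (rule PiE_ext[OF aa(1,2)[unfolded E_def]]) (use aa(3) mult_g in metis)
  qed
  moreover have "g ` E \<subseteq> {n \<in> {N<..2*N}. n \<in> S_numbers (insert 2 S)}"
  proof -
    have "g a \<in> S_numbers (insert 2 S)" for a
    proof -
      have "prime_factors (h a) \<subseteq> S"
      proof
        fix q assume "q \<in> prime_factors (h a)"
        hence q: "prime q" "q dvd h a" by auto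
        then obtain p where "p \<in> S" "q dvd p ^ a p" unfolding h_def using fin by (auto simp: prime_dvd_prod_iff)
        thus "q \<in> S" using q pr by (metis prime_dvd_power primes_dvd_imp_eq)
      qed
      moreover have "prime_factors (2 ^ k a :: nat) \<subseteq> {2}"
      proof
        fix q :: nat assume "q \<in> prime_factors (2 ^ k a)"
        hence "prime q" "q dvd 2 ^ k a" by auto
        thus "q \<in> {2}" by (metis prime_dvd_power primes_dvd_imp_eq singletonI two_is_prime_nat)
      qed
      moreover have "prime_factors (g a) = prime_factors (2 ^ k a :: nat) \<union> prime_factors (h a)"
        unfolding g_def using hpos[of a] by (subst prime_factors_product) auto
      ultimately show ?thesis using hpos[of a] by (auto simp: S_numbers_def g_def)
    qed
    thus ?thesis using g_in by auto
  qed
  ultimately have "card E \<le> card {n \<in> {N<..2*N}. n \<in> S_numbers (insert 2 S)}"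
    by (intro card_inj_on_le[of g]) auto
  moreover have "(l / \<theta>) ^ t \<le> real (card E)"
  proof -
    \<comment> \<open>The mean of the factors \<open>t ln p / \<theta>\<close> is 1; \<open>z \<le> exp (z - 1)\<close> then bounds their product by 1.\<close>
    have "(\<Prod>p\<in>S. real t * ln (real p) / \<theta>) \<le> (\<Prod>p\<in>S. exp (real t * ln (real p) / \<theta> - 1))"
    proof (intro prod_mono conjI)
      fix p assume p: "p \<in> S"
      show "0 \<le> real t * ln (real p) / \<theta>" using lnp[OF p] \<theta> by simp
      show "real t * ln (real p) / \<theta> \<le> exp (real t * ln (real p) / \<theta> - 1)"
        using exp_ge_add_one_self[of "real t * ln (real p) / \<theta> - 1"] by simp
    qed
    also have "\<dots> = exp (\<Sum>p\<in>S. real t * ln (real p) / \<theta> - 1)" using fin by (simp add: exp_sum)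
    also have "(\<Sum>p\<in>S. real t * ln (real p) / \<theta> - 1) = real t * \<theta> / \<theta> - real t"
      by (simp add: sum_subtractf t_def \<theta>_def sum_distrib_left sum_divide_distrib)
    finally have amgm: "(\<Prod>p\<in>S. real t * ln (real p) / \<theta>) \<le> 1" using \<theta> by simp
    have "(l / \<theta>) ^ t = (\<Prod>p\<in>S. (l / (real t * ln (real p))) * (real t * ln (real p) / \<theta>))"
    proof -
      have "(\<Prod>p\<in>S. (l / (real t * ln (real p))) * (real t * ln (real p) / \<theta>)) = (\<Prod>p\<in>S. l / \<theta>)"
        using t by (intro prod.cong refl) (auto simp: field_simps dest: lnp)
      thus ?thesis by (simp add: t_def)
    qed
    also have "\<dots> = (\<Prod>p\<in>S. l / (real t * ln (real p))) * (\<Prod>p\<in>S. real t * ln (real p) / \<theta>)"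
      by (rule prod.distrib)
    also have "\<dots> \<le> (\<Prod>p\<in>S. l / (real t * ln (real p))) * 1"
      using l lnp by (intro mult_left_mono amgm prod_nonneg) (auto simp: less_imp_le intro!: divide_nonneg_nonneg mult_nonneg_nonneg)
    also have "\<dots> \<le> (\<Prod>p\<in>S. real (b p + 1))"
      unfolding mult_1_right
    proof (intro prod_mono conjI)
      fix p assume p: "p \<in> S"
      show "0 \<le> l / (real t * ln (real p))" using lnp[OF p] l by simp
      show "l / (real t * ln (real p)) \<le> real (b p + 1)" unfolding b_def by linarith
    qed
    also have "\<dots> = real (card E)" using fin by (simp add: E_def card_PiE)
    finally show ?thesis .
  qed
  ultimately show ?thesis unfolding t_def l_def \<theta>_def by linarith
qed

section \<open>Additive decompositions of the smooth numbers\<close>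

definition primes_upto :: "real \<Rightarrow> nat set" where
  "primes_upto Y = {p. prime p \<and> real p \<le> Y}"

lemma primes_upto_eq: "primes_upto Y = {p. prime p \<and> p \<le> nat \<lfloor>Y\<rfloor>}"
proof -
  have "real p \<le> Y \<longleftrightarrow> p \<le> nat \<lfloor>Y\<rfloor>" if "prime p" for p
    using prime_gt_0_nat[OF that] by linarith
  thus ?thesis by (auto simp: primes_upto_def)
qed

lemma finite_primes_upto [simp]: "finite (primes_upto Y)"
  unfolding primes_upto_eq by simp

lemma primes_upto_mono: "Y \<le> Z \<Longrightarrow> primes_upto Y \<subseteq> primes_upto Z"
  by (auto simp: primes_upto_def)

lemma smooth_numbers_iff:
  assumes "n \<ge> 2"
  shows "n \<in> smooth_numbers y \<longleftrightarrow> n \<in> S_numbers (primes_upto (y n))"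
proof -
  have "prime_factors n \<noteq> {}" using assms by (auto simp: prime_factorization_empty_iff)
  hence "real (Max (prime_factors n)) \<le> y n \<longleftrightarrow> (\<forall>p\<in>prime_factors n. real p \<le> y n)"
  proof -
    have fin: "finite (prime_factors n)" by simp
    show ?thesis
    proof
      assume "real (Max (prime_factors n)) \<le> y n"
      thus "\<forall>p\<in>prime_factors n. real p \<le> y n"
        using Max_ge[OF fin] by (meson of_nat_le_iff order_trans)
    next
      assume "\<forall>p\<in>prime_factors n. real p \<le> y n"
      thus "real (Max (prime_factors n)) \<le> y n"
        using Max_in[OF fin \<open>prime_factors n \<noteq> {}\<close>] by auto
    qed
  qed
  thus ?thesis using assms
    by (auto simp: smooth_numbers_def greatest_prime_factor_def S_numbers_def primes_upto_def)
qed

lemma sumset_card_le: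
  fixes B C :: "nat set"
  shows "card ((B + C) \<inter> {..n}) \<le> card (B \<inter> {..n}) * card (C \<inter> {..n})"
proof -
  have "(B + C) \<inter> {..n} \<subseteq> (\<lambda>(b, c). b + c) ` ((B \<inter> {..n}) \<times> (C \<inter> {..n}))"
    by (force simp: set_plus_def)
  hence "card ((B + C) \<inter> {..n}) \<le> card ((B \<inter> {..n}) \<times> (C \<inter> {..n}))"
    by (rule surj_card_le[rotated]) auto
  thus ?thesis by (simp add: card_cartesian_product)
qed

lemma ex_less_pair:
  fixes B :: "nat set"
  assumes "infinite B \<or> card B \<ge> 2"
  shows "\<exists>b\<in>B. \<exists>b'\<in>B. b < b'"
proof -
  have "\<exists>a b. a \<in> B \<and> b \<in> B \<and> a \<noteq> b"
  proof (rule ccontr)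
    assume "\<not> ?thesis"
    hence "B = {} \<or> (\<exists>a. B = {a})" by blast
    thus False using assms by auto
  qed
  thus ?thesis by (metis linorder_neqE_nat)
qed

text \<open>
  Two elements \<open>b < b'\<close> of one summand make the other one thin: the translate \<open>c + b\<close> of each of its
  elements, apart from those that fall below \<open>K\<close>, is smooth together with \<open>c + b' = (c + b) + (b' - b)\<close>,
  and both numbers are at most \<open>2 ^ (m + 1)\<close>, so their prime factors are among those admissible there.
\<close>
lemma summand_card_le:
  assumes mono: "mono_on {1..} y"
    and eq: "(B + C) \<inter> {K..} = smooth_numbers y \<inter> {K..}" and K: "K \<ge> 2"
    and b: "b \<in> B" "b' \<in> B" "b < b'" "b' \<le> 2 ^ m" and m: "2 \<in> primes_upto (y (2 ^ (m + 1)))"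
  shows "card (C \<inter> {..2 ^ m}) \<le> K + 6 * (b' - b) ^ 3 + (m + 1) * 32 ^ card (primes_upto (y (2 ^ (m + 1))))"
proof -
  define S where "S = primes_upto (y (2 ^ (m + 1)))"
  define d where "d = b' - b"
  let ?X = "{x \<in> {..2 ^ (m + 1)}. x \<in> S_numbers S \<and> x + d \<in> S_numbers S}"
  have S_mem: "x \<in> S_numbers S" if "x \<in> B + C" "K \<le> x" "x \<le> 2 ^ (m + 1)" for x
  proof -
    have "x \<in> smooth_numbers y" using that eq by blast
    hence "x \<in> S_numbers (primes_upto (y x))" using smooth_numbers_iff[of x y] that K by simp
    moreover have "primes_upto (y x) \<subseteq> S" unfolding S_def
      by (intro primes_upto_mono mono_onD[OF mono]) (use that K in auto)
    ultimately show ?thesis by (auto simp: S_numbers_def)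
  qed
  have "(\<lambda>c. c + b) ` (C \<inter> {..2 ^ m}) \<subseteq> {..<K} \<union> ?X"
  proof
    fix x assume "x \<in> (\<lambda>c. c + b) ` (C \<inter> {..2 ^ m})"
    then obtain c where c: "c \<in> C" "c \<le> 2 ^ m" "x = c + b" by auto
    have xd: "x + d = b' + c" using b c by (simp add: d_def)
    have "b + c \<in> B + C" "b' + c \<in> B + C" using b c by (auto intro: set_plus_intro)
    hence "x \<in> B + C" "x + d \<in> B + C" unfolding xd by (simp_all add: c add.commute)
    moreover have "x + d \<le> 2 ^ (m + 1)" unfolding xd using c b by simp
    ultimately show "x \<in> {..<K} \<union> ?X" using S_mem[of x] S_mem[of "x + d"] by (cases "x < K") auto
  qed
  hence "card (C \<inter> {..2 ^ m}) \<le> card ({..<K} \<union> ?X)"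
    by (intro card_inj_on_le[of "\<lambda>c. c + b"]) (auto simp: inj_on_def)
  also have "\<dots> \<le> card {..<K} + card ?X" by (rule card_Un_le)
  also have "card ?X \<le> 6 * d ^ 3 + (m + 1) * 32 ^ card S"
  proof (rule card_S_pairs_le)
    show "finite S" "S \<noteq> {}" "\<And>p. p \<in> S \<Longrightarrow> prime p"
      using m by (auto simp: S_def) (auto simp: primes_upto_def)
    show "d > 0" using b by (simp add: d_def)
  qed
  finally show ?thesis by (simp add: d_def S_def)
qed

text \<open>
  Otherwise \<open>f\<close> would increase by at least 1 at each step from \<open>j1\<close> on, and so outgrow \<open>j / 2\<close>.
\<close>
lemma ex_stationary_index:
  fixes f :: "nat \<Rightarrow> nat"
  assumes mono: "mono f" and le: "\<And>j. j \<ge> j0 \<Longrightarrow> 2 * f j \<le> j"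
  shows "\<exists>j\<ge>j1. f (Suc j) = f j"
proof (rule ccontr)
  assume "\<not> ?thesis"
  hence "f j < f (Suc j)" if "j \<ge> j1" for j
    using monoD[OF mono, of j "Suc j"] that by (metis le_less less_Suc_eq order_refl)
  have *: "f (j1 + i) \<ge> i" for i
  proof (induction i)
    case (Suc i)
    thus ?case using \<open>\<And>j. j \<ge> j1 \<Longrightarrow> f j < f (Suc j)\<close>[of "j1 + i"] by simp
  qed simp
  have "2 * f (j1 + (j0 + j1 + 1)) \<le> j1 + (j0 + j1 + 1)" by (intro le) simp
  with *[of "j0 + j1 + 1"] show False by simp
qed

text \<open>The constant 2 is a convenient upper bound for \<open>ln 4\<close>, which the primorial bound yields.\<close>
lemma sum_ln_primes_upto_le:
  assumes "Y \<ge> 0"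
  shows "(\<Sum>p\<in>primes_upto Y. ln (real p)) \<le> 2 * Y"
proof -
  define m where "m = nat \<lfloor>Y\<rfloor>"
  have "(\<Sum>p\<in>primes_upto Y. ln (real p)) = ln (real (\<Prod>(primes_upto Y)))"
    using finite_primes_upto[of Y]
    by (subst of_nat_prod, subst ln_prod) (auto simp: primes_upto_def prime_gt_0_nat)
  also have "\<dots> \<le> ln (real (4 ^ m))"
  proof (subst ln_le_cancel_iff)
    have "\<Prod>(primes_upto Y) \<le> 4 ^ m" unfolding primes_upto_eq m_def by (rule primorial_le)
    thus "real (\<Prod>(primes_upto Y)) \<le> real (4 ^ m)" by (rule of_nat_mono)
  qed (auto simp: primes_upto_def intro!: prod_pos prime_gt_0_nat)
  also have "\<dots> = real m * ln 4" by (simp add: ln_realpow)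
  also have "ln (4::real) \<le> 2"
  proof -
    have "ln (4::real) = ln (2 ^ 2)" by simp
    also have "\<dots> = 2 * ln 2" by (subst ln_realpow) auto
    also have "\<dots> \<le> 2" using ln_le_minus_one[of "2::real"] by simp
    finally show ?thesis .
  qed
  hence "real m * ln 4 \<le> real m * 2" by (intro mult_left_mono) auto
  also have "\<dots> \<le> 2 * Y" using assms by (simp add: m_def)
  finally show ?thesis .
qed

text \<open>
  The numerical comparison of the two counts. Here \<open>L\<close> stands for \<open>ln N\<close> where \<open>N = 4 ^ j\<close>, \<open>R\<close> for the
  base of the lower bound, \<open>D\<close> for the bound on each summand and \<open>Y\<close> for the bound on the primes.
  As \<open>j \<le> L = 2 Y R\<close> and \<open>Y \<le> 2 * 4 ^ s\<close>, the bound \<open>D\<close> is at most \<open>20 R * 128 ^ s\<close>. Two of the factors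
  \<open>R\<close> cancel those in \<open>D\<^sup>2\<close>, and the other \<open>s - 3\<close> exceed \<open>400 * 2 ^ (14 s)\<close>.
\<close>
lemma counting_contradiction:
  fixes R L Y D :: real and j s :: nat
  assumes s: "s \<ge> 6" and R: "R \<ge> 2 ^ 31" and L: "L = 2 * Y * R" and Y: "Y \<ge> 0" "Y \<le> 2 * 4 ^ s"
    and j: "real j \<le> L" "j \<ge> 1" and D: "0 \<le> D" "D \<le> real j + (2 * real j + 2) * 32 ^ s"
  shows "D ^ 2 < R ^ (s - 1)"
proof -
  have "real j * 1 \<le> real j * 32 ^ s" by (intro mult_left_mono one_le_power) auto
  moreover have "(2 * real j + 2) * 32 ^ s \<le> (4 * real j) * 32 ^ s"
    using j by (intro mult_right_mono) auto
  ultimately have "D \<le> 5 * (real j * 32 ^ s)" using D by linarith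
  hence "D \<le> 5 * real j * 32 ^ s" by simp
  also have "\<dots> \<le> 5 * L * 32 ^ s" using j by (intro mult_right_mono) auto
  also have "\<dots> = (10 * R * 32 ^ s) * Y" by (simp add: L)
  also have "\<dots> \<le> (10 * R * 32 ^ s) * (2 * 4 ^ s)" using Y R by (intro mult_left_mono) auto
  also have "\<dots> = 20 * R * 128 ^ s" by (simp flip: power_mult_distrib)
  finally have "D ^ 2 \<le> (20 * R * 128 ^ s) ^ 2" using D by (intro power_mono) auto
  also have "\<dots> = 400 * R ^ 2 * (2 ^ 14) ^ s"
    by (simp add: power_mult_distrib power_mult[symmetric] mult.commute[of s]) (simp add: power_mult)
  also have "\<dots> < R ^ 2 * R ^ (s - 3)"
  proof -
    obtain r where r: "s = r + 6" using s by (metis add.commute le_Suc_ex)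
    have "400 * (2 ^ 14) ^ s = (400 * (2::real) ^ 84) * (2 ^ 14) ^ r"
      by (simp add: r power_add)
    also have "\<dots> < 2 ^ 93 * (2 ^ 14) ^ r" by (intro mult_strict_right_mono) auto
    also have "\<dots> \<le> 2 ^ 93 * (2 ^ 31) ^ r" by (intro mult_left_mono power_mono) auto
    also have "\<dots> = (2 ^ 31) ^ (s - 3)" by (simp add: r power_add)
    also have "\<dots> \<le> R ^ (s - 3)" using R by (intro power_mono) auto
    finally have "400 * (2 ^ 14) ^ s < R ^ (s - 3)" .
    hence "R ^ 2 * (400 * (2 ^ 14) ^ s) < R ^ 2 * R ^ (s - 3)"
      using R by (intro mult_strict_left_mono) auto
    thus ?thesis by (simp add: mult_ac)
  qed
  also have "\<dots> = R ^ (2 + (s - 3))" by (rule power_add[symmetric])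
  also have "2 + (s - 3) = s - 1" using s by simp
  finally show ?thesis .
qed

text \<open>The large powers of 2 are smooth.\<close>
lemma infinite_smooth_numbers:
  assumes "filterlim y at_top sequentially"
  shows "infinite (smooth_numbers y)"
proof -
  obtain n0 where n0: "\<And>n. n \<ge> n0 \<Longrightarrow> y n \<ge> 2"
    using assms by (auto simp: filterlim_at_top eventually_sequentially)
  have "2 ^ (n0 + n + 1) \<in> smooth_numbers y" for n
  proof -
    have "n0 < 2 ^ n0" by (rule less_exp)
    also have "(2::nat) ^ n0 \<le> 2 ^ (n0 + n + 1)" by (intro power_increasing) auto
    finally have "y (2 ^ (n0 + n + 1)) \<ge> 2" by (intro n0) simp
    hence "2 \<in> primes_upto (y (2 ^ (n0 + n + 1)))" by (simp add: primes_upto_def)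
    moreover have "q = 2" if "q \<in> prime_factors (2 ^ (n0 + n + 1))" for q :: nat
      using that by (metis in_prime_factors_iff prime_dvd_power primes_dvd_imp_eq two_is_prime_nat)
    ultimately have "2 ^ (n0 + n + 1) \<in> S_numbers (primes_upto (y (2 ^ (n0 + n + 1))))"
      by (auto simp: S_numbers_def simp del: power_Suc)
    thus ?thesis by (subst smooth_numbers_iff) auto
  qed
  hence "range (\<lambda>n. 2 ^ (n0 + n + 1)) \<subseteq> smooth_numbers y" by auto
  moreover have "infinite (range (\<lambda>n. 2 ^ (n0 + n + 1) :: nat))"
    by (auto simp: inj_def dest!: finite_imageD)
  ultimately show ?thesis by (rule infinite_super)
qed

theorem theorem1p1:
  fixes y :: "nat \<Rightarrow> real"
  assumes "\<And>n. n \<ge> 1 \<Longrightarrow> y n > 0"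
    and "mono_on {1..} y"
    and "filterlim y at_top sequentially"
    and "eventually (\<lambda>n. y n < 2 powr (-32) * ln (real n)) sequentially"
  shows "totally_a_primitive (smooth_numbers y)"
proof -
  note pos = assms(1) and mono = assms(2)
  have False if eqA: "asymptotically_equal (B + C) (smooth_numbers y)"
    and B: "infinite B \<or> card B \<ge> 2" and C: "infinite C \<or> card C \<ge> 2" for B C
  proof -
    obtain K0 where K0: "(B + C) \<inter> {K0..} = smooth_numbers y \<inter> {K0..}"
      using eqA by (auto simp: asymptotically_equal_def)
    define K where "K = max K0 2"
    have "(B + C) \<inter> {K..} = ((B + C) \<inter> {K0..}) \<inter> {K..}" by (auto simp: K_def)
    also have "\<dots> = smooth_numbers y \<inter> {K..}" unfolding K0 by (auto simp: K_def)
    finally have eq: "(B + C) \<inter> {K..} = smooth_numbers y \<inter> {K..}" .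
    hence eq': "(C + B) \<inter> {K..} = smooth_numbers y \<inter> {K..}" by (simp add: add.commute)
    have K2: "K \<ge> 2" by (simp add: K_def)
    obtain b b' where b: "b \<in> B" "b' \<in> B" "b < b'" using ex_less_pair[OF B] by blast
    obtain c c' where c: "c \<in> C" "c' \<in> C" "c < c'" using ex_less_pair[OF C] by blast
    define M where "M = K + 6 * (b' - b) ^ 3 + 6 * (c' - c) ^ 3"
    obtain n0 where n0: "\<And>n. n \<ge> n0 \<Longrightarrow> y n < 2 powr (-32) * ln (real n)"
      using assms(4) by (auto simp: eventually_sequentially)
    obtain n1 where n1: "\<And>n. n \<ge> n1 \<Longrightarrow> y n \<ge> 13"
      using assms(3) by (auto simp: filterlim_at_top eventually_sequentially)
    define f where "f = (\<lambda>j::nat. card (primes_upto (y (4 ^ j))))"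
    have incr: "primes_upto (y (4 ^ i)) \<subseteq> primes_upto (y (4 ^ j))" if "i \<le> j" for i j
      by (intro primes_upto_mono mono_onD[OF mono]) (use that in \<open>auto intro: power_increasing\<close>)
    have exp4: "j \<le> (4::nat) ^ j" for j
      using less_exp[of j] power_mono[of 2 "4::nat" j] by linarith
    have ln4: "1 \<le> ln (4::real)" using exp_le by (subst ln_ge_iff) auto
    have ln4': "ln (4::real) \<le> 2" using ln_realpow[of 2 2] ln_le_minus_one[of "2::real"] by auto
    have y_less: "2 ^ 32 * y (4 ^ j) < real j * ln 4" if "j \<ge> n0" for j
    proof -
      have "y (4 ^ j) < 2 powr (-32) * ln (real (4 ^ j))"
        using that exp4[of j] by (intro n0 order_trans[OF that])
      also have "\<dots> = real j * ln 4 / 2 ^ 32"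
        by (simp add: ln_realpow powr_minus powr_numeral field_simps)
      finally show ?thesis by (simp add: field_simps)
    qed
    \<comment> \<open>A scale \<open>N = 4 ^ j\<close> at which the admissible primes are the same for \<open>N\<close> and \<open>4 N\<close>, and
      which is large compared with all constants that depend only on \<open>B\<close> and \<open>C\<close>.\<close>
    have "\<exists>j\<ge>max (max n0 n1) (max (M + 1) (b' + c')). f (Suc j) = f j"
    proof (rule ex_stationary_index)
      show "mono f" unfolding f_def by (intro monoI card_mono incr) auto
    next
      fix j assume j: "j \<ge> n0"
      have "primes_upto (y (4 ^ j)) \<subseteq> {1..nat \<lfloor>y (4 ^ j)\<rfloor>}"
        unfolding primes_upto_eq by (auto simp: prime_ge_Suc_0_nat)
      hence "card (primes_upto (y (4 ^ j))) \<le> card {1..nat \<lfloor>y (4 ^ j)\<rfloor>}" by (intro card_mono) auto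
      hence "real (f j) \<le> y (4 ^ j)" using pos[of "4 ^ j"] by (simp add: f_def) linarith
      also have "2 * y (4 ^ j) \<le> real j"
      proof -
        have "real j * ln 4 \<le> real j * 2" using ln4' by (intro mult_left_mono) auto
        thus ?thesis using y_less[OF j] pos[of "4 ^ j"] by simp
      qed
      finally show "2 * f j \<le> j" by linarith
    qed
    then obtain j where j: "j \<ge> n0" "j \<ge> n1" "j \<ge> M + 1" "j \<ge> b' + c'" and f: "f (Suc j) = f j" by auto
    define Y where "Y = y (4 ^ j)"
    define S where "S = primes_upto Y"
    define s where "s = card S"
    have S': "primes_upto (y (4 ^ Suc j)) = S"
      unfolding S_def Y_def using f incr[of j "Suc j"]
      by (intro card_subset_eq[symmetric]) (auto simp: f_def)
    \<comment> \<open>The sixth prime is 13, so \<open>y N \<ge> 13\<close> provides the six primes that the final comparison needs.\<close>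
    have Y13: "Y \<ge> 13" unfolding Y_def using exp4[of j] by (intro n1 order_trans[OF j(2)])
    have "{2, 3, 5, 7, 11, 13} \<subseteq> S" using Y13 by (auto simp: S_def primes_upto_def)
    hence "card {2, 3, 5, 7, 11, 13::nat} \<le> s" unfolding s_def by (intro card_mono) (auto simp: S_def)
    hence s6: "s \<ge> 6" by simp
    have two: "2 \<in> S" using Y13 by (simp add: S_def primes_upto_def)

    \<comment> \<open>The summands are counted up to \<open>2 ^ m = 2 N\<close>, and the translated elements stay below \<open>4 N\<close>.\<close>
    define m where "m = 2 * j + 1"
    have m4: "(2::nat) ^ (m + 1) = 4 ^ Suc j" "(2::nat) ^ m = 2 * 4 ^ j"
      by (simp_all add: m_def power_mult)
    have bc: "b' \<le> 2 ^ m" "c' \<le> 2 ^ m" using j(4) exp4[of j] unfolding m4 by linarith+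
    define D where "D = M + (2 * j + 2) * 32 ^ s"
    have "card (C \<inter> {..2 ^ m}) \<le> D"
      using summand_card_le[OF mono eq K2 b bc(1)] two unfolding m4 S' by (simp add: D_def M_def m_def s_def)
    moreover have "card (B \<inter> {..2 ^ m}) \<le> D"
      using summand_card_le[OF mono eq' K2 c bc(2)] two unfolding m4 S' by (simp add: D_def M_def m_def s_def)
    ultimately have "card (B \<inter> {..2 ^ m}) * card (C \<inter> {..2 ^ m}) \<le> D * D" by (intro mult_mono) auto
    hence upper: "card ((B + C) \<inter> {..2 ^ m}) \<le> D ^ 2"
      using sumset_card_le[of B C "2 ^ m"] by (simp add: power2_eq_square)

    \<comment> \<open>All numbers between \<open>N\<close> and \<open>2 N\<close> with prime factors in \<open>S\<close> must be produced by \<open>B + C\<close>.\<close>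
    let ?W = "{n \<in> {4 ^ j<..2 * 4 ^ j}. n \<in> S_numbers S}"
    have "?W \<subseteq> (B + C) \<inter> {..2 ^ m}"
    proof
      fix n assume n: "n \<in> ?W"
      have nK: "n \<ge> K"
      proof -
        have "K \<le> j" using j(3) by (simp add: M_def)
        also have "j \<le> 4 ^ j" by (rule exp4)
        also have "4 ^ j \<le> n" using n by auto
        finally show ?thesis .
      qed
      have "S \<subseteq> primes_upto (y n)" unfolding S_def Y_def using n
        by (intro primes_upto_mono mono_onD[OF mono]) auto
      hence "n \<in> smooth_numbers y" using n nK K2 by (subst smooth_numbers_iff) (auto simp: S_numbers_def)
      thus "n \<in> (B + C) \<inter> {..2 ^ m}" using nK eq n unfolding m4 by auto
    qed
    hence "card ?W \<le> card ((B + C) \<inter> {..2 ^ m})" by (intro card_mono) auto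
    hence "card ?W \<le> D ^ 2" using upper by (rule order_trans)
    hence "real (card ?W) \<le> real (D ^ 2)" by (rule of_nat_mono)
    hence W: "real (card ?W) \<le> real D ^ 2" by simp

    define L where "L = ln (real (4 ^ j))"
    have L: "L = real j * ln 4" by (simp add: L_def ln_realpow)
    have L_gt: "2 ^ 32 * Y < L" using y_less[OF j(1)] by (simp add: L Y_def)
    define R where "R = L / (2 * Y)"
    have R: "R \<ge> 2 ^ 31" using L_gt Y13 by (simp add: R_def field_simps)
    define \<theta> where "\<theta> = (\<Sum>p\<in>S - {2}. ln (real p))"
    have finS: "finite S" by (simp add: S_def)
    have S2: "card (S - {2}) = s - 1" using two by (simp add: s_def S_def)
    hence ne: "S - {2} \<noteq> {}" using s6 by (intro notI) simp
    have \<theta>_pos: "\<theta> > 0" unfolding \<theta>_def using ne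
      by (intro sum_pos) (use finS in \<open>auto simp: S_def primes_upto_def dest: prime_gt_1_nat\<close>)
    have "\<theta> \<le> (\<Sum>p\<in>S. ln (real p))" unfolding \<theta>_def
      by (intro sum_mono2 finS) (auto simp: S_def primes_upto_def prime_ge_Suc_0_nat)
    also have "\<dots> \<le> 2 * Y" unfolding S_def using Y13 by (intro sum_ln_primes_upto_le) auto
    finally have "R \<le> L / \<theta>" unfolding R_def using \<theta>_pos L_gt Y13 by (intro divide_left_mono) auto
    hence "R ^ (s - 1) \<le> (L / \<theta>) ^ (s - 1)" using R by (intro power_mono) auto
    also have "\<dots> \<le> real (card {n \<in> {4 ^ j<..2 * 4 ^ j}. n \<in> S_numbers (insert 2 (S - {2}))})"
      unfolding L_def \<theta>_def S2[symmetric]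
    proof (rule card_S_numbers_dyadic_ge)
      show "finite (S - {2})" "S - {2} \<noteq> {}" "1 \<le> (4::nat) ^ j" using ne by (simp_all add: S_def)
    next
      fix p assume "p \<in> S - {2}"
      hence "prime p" "p \<noteq> 2" by (auto simp: S_def primes_upto_def)
      thus "prime p \<and> odd p" using prime_odd_nat[of p] prime_gt_1_nat[of p] by auto
    qed
    also have "insert 2 (S - {2}) = S" using two by auto
    also note W
    finally have "R ^ (s - 1) \<le> real D ^ 2" .
    moreover have "real D ^ 2 < R ^ (s - 1)"
    proof (rule counting_contradiction[of _ _ L Y])
      have "Y \<le> real (nat \<lfloor>Y\<rfloor>) + 1" using Y13 by linarith
      also have "nat \<lfloor>Y\<rfloor> \<le> 4 ^ s"
        using le_4_power_card_primes[of "nat \<lfloor>Y\<rfloor>"] by (simp add: s_def S_def primes_upto_eq)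
      hence "real (nat \<lfloor>Y\<rfloor>) \<le> real (4 ^ s)" by (rule of_nat_mono)
      hence "real (nat \<lfloor>Y\<rfloor>) + 1 \<le> 4 ^ s + 1" by simp
      also have "\<dots> \<le> 2 * 4 ^ s" by simp
      finally show "Y \<le> 2 * 4 ^ s" .
      have "real j * 1 \<le> real j * ln 4" using ln4 by (intro mult_left_mono) auto
      thus "real j \<le> L" by (simp add: L)
      show "real D \<le> real j + (2 * real j + 2) * 32 ^ s" using j by (simp add: D_def algebra_simps)
    qed (use s6 R Y13 j in \<open>auto simp: R_def\<close>)
    ultimately show False by simp
  qed
  thus ?thesis using infinite_smooth_numbers[OF assms(3)]
    by (auto simp: totally_a_primitive_def a_primitive_def a_reducible_def)
qed

end
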